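(* Let $p$ be a prime. Let $\lambda=(\lambda_1\geq\cdots\geq\lambda_l)$ and $\mu=(\mu_1\geq\cdots\geq\mu_m)$ be partitions, and let $a\in A_{p,\lambda}$ and $b\in A_{p,\mu}$. Then $a$ degenerates to $b$ if and only if $I(a)\supset I(b)$.
   Context: A partition is a non-increasing sequence $\lambda=(\lambda_1\geq\cdots\geq\lambda_l)$ of positive integers, and $A_{p,\lambda}=\mathbf{Z}/p^{\lambda_1}\mathbf{Z}\oplus\cdots\oplus\mathbf{Z}/p^{\lambda_l}\mathbf{Z}$. If $A$ and $B$ are groups, $a\in A$, $b\in B$, then $a$ degenerates to $b$ (written $a\to b$) if there is a homomorphism $\phi:A\to B$ with $\phi(a)=b$. Fundamental poset $P$: its elements are the orbits of non-zero elements of the groups $\mathbf{Z}/p^k\mathbf{Z}$ ($k\geq 1$) under their automorphism groups. They are the symbols $(p^r,k)$ with integers $0\leq r<k$, where $(p^r,k)$ is the orbit of $p^r$ in $\mathbf{Z}/p^k\mathbf{Z}$, i.e. the set of elements $p^ru$ with $p\nmid u$. The partial order is degeneration: $(p^r,k)\geq(p^s,l)$ if and only if $p^r\in\mathbf{Z}/p^k\mathbf{Z}$ degenerates to $p^s\in\mathbf{Z}/p^l\mathbf{Z}$, equivalently $r\leq s$ and $k-r\geq l-s$. An ideal of a poset is a (possibly empty) down-closed subset: if $x$ is in it and $x\geq y$ then $y$ is in it. The ideal generated by a subset is the smallest ideal containing it. For $a=(a_1,\ldots,a_l)\in A_{p,\lambda}$, the ideal $I(a)$ of $P$ is the ideal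 generated by the orbits of the non-zero coordinates $a_i\in\mathbf{Z}/p^{\lambda_i}\mathbf{Z}$ (so $a_i=p^{r}u\neq 0$ with $p\nmid u$ contributes the element $(p^r,\lambda_i)$). *)

theory Defs
  imports
    "HOL.Hull"
    "HOL-Algebra.Group_Action"
    "HOL-Algebra.Product_Groups"
    "HOL-Computational_Algebra.Primes"
begin

definition is_partition :: "nat list \<Rightarrow> bool" where
  "is_partition lam \<longleftrightarrow> sorted_wrt (\<ge>) lam \<and> (\<forall>x\<in>set lam. 0 < x)"

text \<open>The index set is finite, so the direct product is the direct sum. Coordinates are
  indexed from 0, and the coordinates of an element are canonical residues.\<close>

definition part_group :: "nat \<Rightarrow> nat list \<Rightarrow> (nat \<Rightarrow> int) monoid" where
  "part_group p lam = product_group {..<length lam} (\<lambda>i. integer_mod_group (p ^ (lam ! i)))"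

definition degenerates ::
  "('a, 'c) monoid_scheme \<Rightarrow> 'a \<Rightarrow> ('b, 'd) monoid_scheme \<Rightarrow> 'b \<Rightarrow> bool" where
  "degenerates A a B b \<longleftrightarrow> (\<exists>\<phi>\<in>hom A B. \<phi> a = b)"

text \<open>The automorphism orbit of an element x of Z/p^k. It is tagged with the exponent k, so that
  orbits in different groups are different objects.\<close>

definition fund_orbit :: "nat \<Rightarrow> nat \<Rightarrow> int \<Rightarrow> nat \<times> int set" where
  "fund_orbit p k x = (k, orbit (AutoGroup (integer_mod_group (p ^ k))) (\<lambda>f. f) x)"

definition fund_poset :: "nat \<Rightarrow> (nat \<times> int set) set" where
  "fund_poset p =
    {fund_orbit p k x | k x. 1 \<le> k \<and> x \<in> carrier (integer_mod_group (p ^ k)) \<and> x \<noteq> 0}"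

text \<open>The choice of representatives is immaterial, because they may be moved by automorphisms.\<close>

definition fund_ge :: "nat \<Rightarrow> nat \<times> int set \<Rightarrow> nat \<times> int set \<Rightarrow> bool" where
  "fund_ge p X Y \<longleftrightarrow>
    (\<exists>x\<in>snd X. \<exists>y\<in>snd Y.
       degenerates (integer_mod_group (p ^ fst X)) x (integer_mod_group (p ^ fst Y)) y)"

definition fund_ideal :: "nat \<Rightarrow> (nat \<times> int set) set \<Rightarrow> bool" where
  "fund_ideal p J \<longleftrightarrow>
    J \<subseteq> fund_poset p \<and> (\<forall>X\<in>J. \<forall>Y\<in>fund_poset p. fund_ge p X Y \<longrightarrow> Y \<in> J)"

definition elem_ideal :: "nat \<Rightarrow> nat list \<Rightarrow> (nat \<Rightarrow> int) \<Rightarrow> (nat \<times> int set) set" where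
  "elem_ideal p lam a =
    fund_ideal p hull {fund_orbit p (lam ! i) (a i) | i. i < length lam \<and> a i \<noteq> 0}"

text \<open>The remaining facts identify the orbits with the symbols (p^r, k), where r < k, and
  the order with the numerical condition on these symbols.\<close>

lemma hom_integer_mod_groupD:
  assumes "\<phi> \<in> hom (integer_mod_group n) (integer_mod_group m)" "1 < n"
  obtains c where "int m dvd int n * c"
    "\<And>x. x \<in> carrier (integer_mod_group n) \<Longrightarrow> \<phi> x = c * x mod int m"
proof
  interpret group_hom "integer_mod_group n" "integer_mod_group m" \<phi>
    using assms(1) by (simp add: group_hom_def group_hom_axioms_def)
  have *: "\<phi> (x mod int n) = \<phi> 1 * x mod int m" for x
    using hom_int_pow[of 1 x] assms(2)
    by (simp add: int_pow_integer_mod_group mult.commute)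
  show "int m dvd int n * \<phi> 1"
    using *[of "int n"] hom_one by (simp add: mod_eq_0_iff_dvd mult.commute)
  show "\<phi> x = \<phi> 1 * x mod int m" if "x \<in> carrier (integer_mod_group n)" for x
    using *[of x] that assms(2) by (simp add: carrier_integer_mod_group)
qed

lemma hom_integer_mod_groupI:
  assumes "int m dvd int n * c" "0 < m" "0 < n"
  shows "(\<lambda>x. c * x mod int m) \<in> hom (integer_mod_group n) (integer_mod_group m)"
proof (rule homI)
  fix x y
  have "int m dvd c * ((x + y) mod int n) - c * (x + y)"
  proof -
    have "c * ((x + y) mod int n) - c * (x + y) = - (int n * c) * ((x + y) div int n)"
      by (simp add: minus_div_mult_eq_mod[symmetric] algebra_simps)
    then show ?thesis using assms(1) by (metis dvd_mult2 dvd_minus_iff)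
  qed
  then have "c * ((x + y) mod int n) mod int m = (c * x + c * y) mod int m"
    by (simp add: mod_eq_dvd_iff distrib_left)
  then show "c * (x \<otimes>\<^bsub>integer_mod_group n\<^esub> y) mod int m =
      (c * x mod int m) \<otimes>\<^bsub>integer_mod_group m\<^esub> (c * y mod int m)"
    by (simp add: mod_add_eq)
qed (use assms in \<open>simp add: carrier_integer_mod_group\<close>)

lemma fund_orbit_prime_power:
  assumes "prime p" "r < k"
  shows "fund_orbit p k (int p ^ r) =
    (k, {x \<in> carrier (integer_mod_group (p ^ k)). \<exists>u. x = int p ^ r * u \<and> \<not> int p dvd u})"
    (is "_ = (k, ?S)")
proof -
  let ?G = "integer_mod_group (p ^ k)"
  have p: "prime (int p)" "1 < p" using assms(1) prime_gt_1_nat by auto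
  have n: "1 < p ^ k" by (rule one_less_power) (use p assms(2) in auto)
  have C: "carrier ?G = {0..<int p ^ k}" using p(2) by (simp add: carrier_integer_mod_group)
  have "int p ^ r < int p ^ k" using p(2) assms(2) by simp
  then have rC: "int p ^ r \<in> carrier ?G" by (simp add: C)
  have "orbit (AutoGroup ?G) (\<lambda>f. f) (int p ^ r) = ?S"
  proof (intro equalityI subsetI)
    fix y assume "y \<in> orbit (AutoGroup ?G) (\<lambda>f. f) (int p ^ r)"
    then obtain f where f: "f \<in> hom ?G ?G" "f \<in> Bij (carrier ?G)" "y = f (int p ^ r)"
      by (auto simp: orbit_def AutoGroup_def auto_def)
    obtain c where c: "\<And>x. x \<in> carrier ?G \<Longrightarrow> f x = c * x mod int (p ^ k)"
      using hom_integer_mod_groupD[OF f(1) n] by metis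
    have "\<not> int p dvd c"
    proof
      assume "int p dvd c"
      then obtain d where d: "c = int p * d" by (elim dvdE)
      define q where "q = int p ^ (k - 1)"
      have q: "int p * q = int p ^ k" using assms(2) by (simp add: q_def power_eq_if)
      have qC: "q \<in> carrier ?G" "q \<noteq> 0" using p(2) assms(2) by (auto simp: C q_def)
      have "c * q = int p ^ k * d" by (simp add: d q[symmetric])
      then have "f q = f 0" using c[OF qC(1)] c[of 0] n by simp
      moreover have "inj_on f (carrier ?G)" using f(2) by (auto simp: Bij_def bij_betw_def)
      ultimately show False using qC by (metis inj_on_eq_iff integer_mod_group_0)
    qed
    define u where "u = c mod int p ^ (k - r)"
    have "\<not> int p dvd u"
    proof -
      have "int p dvd int p ^ (k - r)" using assms(2) by (simp add: dvd_power)
      then show ?thesis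
        using \<open>\<not> int p dvd c\<close> dvd_mod_iff unfolding u_def by blast
    qed
    moreover have "y = int p ^ r * u"
    proof -
      have "int p ^ k = int p ^ r * int p ^ (k - r)"
        using assms(2) by (simp add: power_add[symmetric])
      then have "y = (int p ^ r * c) mod (int p ^ r * int p ^ (k - r))"
        using c[OF rC] f(3) by (simp add: mult.commute)
      then show ?thesis unfolding u_def by (simp only: mult_mod_right)
    qed
    moreover have "y \<in> carrier ?G" using f(1,3) rC by (auto simp: hom_def)
    ultimately show "y \<in> ?S" by auto
  next
    fix y assume "y \<in> ?S"
    then obtain u where u: "y \<in> carrier ?G" "y = int p ^ r * u" "\<not> int p dvd u" by auto
    define g where "g = (\<lambda>x. u * x mod int (p ^ k))"
    have gh: "g \<in> hom ?G ?G"
      unfolding g_def by (rule hom_integer_mod_groupI) (use p(2) in auto)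
    have cop: "coprime (int p ^ k) u"
      using u(3) p(1) by (simp add: prime_imp_coprime)
    have "inj_on g (carrier ?G)"
    proof (rule inj_onI)
      fix x z assume xz: "x \<in> carrier ?G" "z \<in> carrier ?G" "g x = g z"
      then have "int p ^ k dvd u * (x - z)"
        by (simp add: g_def mod_eq_dvd_iff algebra_simps)
      then have "int p ^ k dvd x - z" using cop coprime_dvd_mult_right_iff by blast
      then have "x mod int p ^ k = z mod int p ^ k" by (simp add: mod_eq_dvd_iff)
      then show "x = z" using xz by (simp add: C)
    qed
    moreover have "g ` carrier ?G \<subseteq> carrier ?G" using gh by (auto simp: hom_def)
    ultimately have "bij_betw g (carrier ?G) (carrier ?G)"
      by (simp add: bij_betw_def endo_inj_surj C)
    then have "restrict g (carrier ?G) \<in> Bij (carrier ?G)"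
      by (simp add: Bij_def cong: bij_betw_cong)
    moreover have "restrict g (carrier ?G) \<in> hom ?G ?G"
      using gh group.is_monoid[OF group_integer_mod_group, THEN monoid.m_closed]
      by (auto simp: hom_def simp del: mult_integer_mod_group)
    ultimately have "restrict g (carrier ?G) \<in> auto ?G" by (simp add: auto_def)
    moreover have "restrict g (carrier ?G) (int p ^ r) = y"
      using rC u(1,2) by (simp add: g_def C mult.commute)
    ultimately show "y \<in> orbit (AutoGroup ?G) (\<lambda>f. f) (int p ^ r)"
      unfolding orbit_def AutoGroup_def by (auto intro!: exI[of _ "restrict g (carrier ?G)"])
  qed
  then show ?thesis by (simp add: fund_orbit_def)
qed

lemma fund_ge_prime_power_iff:
  assumes "prime p" "r < k" "s < l"
  shows "fund_ge p (fund_orbit p k (int p ^ r)) (fund_orbit p l (int p ^ s)) \<longleftrightarrow>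
    r \<le> s \<and> l - s \<le> k - r"
proof
  have p: "prime (int p)" "1 < p" using assms(1) prime_gt_1_nat by auto
  have n: "1 < p ^ k" "1 < p ^ l" by (rule one_less_power; use p assms(2,3) in auto)+
  have p1: "\<not> int p dvd 1" using p(1) by (metis not_prime_unit)
  note orb = fund_orbit_prime_power[OF assms(1)]
  {
    assume "fund_ge p (fund_orbit p k (int p ^ r)) (fund_orbit p l (int p ^ s))"
    then obtain u v \<phi> where uv: "\<not> int p dvd v" "int p ^ r * u \<in> carrier (integer_mod_group (p ^ k))"
      and \<phi>: "\<phi> \<in> hom (integer_mod_group (p ^ k)) (integer_mod_group (p ^ l))"
      and e: "\<phi> (int p ^ r * u) = int p ^ s * v"
      by (auto simp: fund_ge_def orb assms degenerates_def)
    obtain c where c: "int p ^ l dvd int p ^ k * c"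
      "\<And>x. x \<in> carrier (integer_mod_group (p ^ k)) \<Longrightarrow> \<phi> x = c * x mod int p ^ l"
      using hom_integer_mod_groupD[OF \<phi> n(1)] by (metis of_nat_power)
    have eq: "c * (int p ^ r * u) mod int p ^ l = int p ^ s * v" using c(2)[OF uv(2)] e by simp
    have d: "int p ^ l dvd c * (int p ^ r * u) - int p ^ s * v"
      unfolding eq[symmetric] by (simp add: minus_mod_eq_mult_div)
    have key: "t \<le> s" if "int p ^ t dvd int p ^ s * v" for t
    proof (rule ccontr)
      assume "\<not> t \<le> s"
      then have "int p ^ Suc s dvd int p ^ s * v"
        using that by (metis dvd_trans le_imp_power_dvd not_less_eq_eq)
      then show False using uv(1) p(2) by simp
    qed
    have "r \<le> s"
    proof (cases "r \<le> l")
      case True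
      then have "int p ^ r dvd c * (int p ^ r * u) - int p ^ s * v"
        using d by (metis dvd_trans le_imp_power_dvd)
      then have "int p ^ r dvd int p ^ s * v"
        by (metis dvd_diff_right_iff dvd_mult dvd_triv_left)
      then show ?thesis by (rule key)
    next
      case False
      then have "int p ^ l dvd c * (int p ^ r * u)"
        by (metis dvd_mult dvd_mult2 le_imp_power_dvd nat_le_linear)
      then have "int p ^ l dvd int p ^ s * v" using d by (metis dvd_diff_right_iff)
      then have "l \<le> s" by (rule key)
      then show ?thesis using assms(3) by simp
    qed
    moreover have "l - s \<le> k - r"
    proof -
      have "int p ^ l dvd int p ^ (k - r) * (c * (int p ^ r * u) - int p ^ s * v)"
        using d by simp
      moreover have "int p ^ (k - r) * (c * (int p ^ r * u) - int p ^ s * v) =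
          int p ^ k * c * u - int p ^ (k - r + s) * v"
      proof -
        have "int p ^ k = int p ^ (k - r) * int p ^ r"
          using assms(2) by (simp add: power_add[symmetric])
        then show ?thesis unfolding power_add by (simp only: algebra_simps)
      qed
      ultimately have "int p ^ l dvd int p ^ (k - r + s) * v"
        using c(1) by (metis dvd_diff_right_iff dvd_mult2)
      moreover have "coprime (int p ^ l) v"
        using uv(1) p(1) by (simp add: prime_imp_coprime)
      ultimately have "int p ^ l dvd int p ^ (k - r + s)"
        by (simp add: coprime_dvd_mult_left_iff)
      then have "l \<le> k - r + s" using p by (simp add: dvd_power_iff)
      then show ?thesis by simp
    qed
    ultimately show "r \<le> s \<and> l - s \<le> k - r" by blast
  next
    assume rs: "r \<le> s \<and> l - s \<le> k - r"
    define c where "c = int p ^ (s - r)"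
    have "int (p ^ l) dvd int (p ^ k) * c"
      unfolding c_def of_nat_power power_add[symmetric]
      by (rule le_imp_power_dvd) (use rs assms in linarith)
    then have h: "(\<lambda>x. c * x mod int (p ^ l)) \<in>
        hom (integer_mod_group (p ^ k)) (integer_mod_group (p ^ l))"
      by (rule hom_integer_mod_groupI) (use p(2) in simp_all)
    have cr: "c * int p ^ r mod int (p ^ l) = int p ^ s"
      using rs assms(3) p(2) by (simp add: c_def power_add[symmetric])
    have "degenerates (integer_mod_group (p ^ k)) (int p ^ r)
        (integer_mod_group (p ^ l)) (int p ^ s)"
      unfolding degenerates_def using h cr by (intro bexI[of _ "\<lambda>x. c * x mod int (p ^ l)"])
    moreover have mem: "int p ^ r \<in> carrier (integer_mod_group (p ^ k))"
      "int p ^ s \<in> carrier (integer_mod_group (p ^ l))"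
      using assms p(2) by (simp_all add: carrier_integer_mod_group)
    moreover have "int p ^ r \<in> snd (fund_orbit p k (int p ^ r))"
      "int p ^ s \<in> snd (fund_orbit p l (int p ^ s))"
      using mem p1 by (auto simp: orb assms intro!: exI[of _ "1::int"])
    ultimately show "fund_ge p (fund_orbit p k (int p ^ r)) (fund_orbit p l (int p ^ s))"
      unfolding fund_ge_def by (metis fund_orbit_def fst_conv)
  }
qed

lemma AutoGroup_action:
  assumes "group G"
  shows "group_action (AutoGroup G) (carrier G) (\<lambda>f. f)"
  unfolding group_action_def group_hom_def group_hom_axioms_def
  using group.AutoGroup[OF assms] group_BijGroup[of "carrier G"]
    group.subgroup_auto[OF assms, THEN subgroup.subset]
  by (auto simp: AutoGroup_def intro!: homI)

lemma fund_poset_eq: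
  assumes "prime p"
  shows "fund_poset p = {fund_orbit p k (int p ^ r) | r k. r < k}"
proof (intro equalityI subsetI)
  have p: "prime (int p)" "1 < p" using assms prime_gt_1_nat by auto
  {
    fix X assume "X \<in> fund_poset p"
    then obtain k x where X: "X = fund_orbit p k x" "1 \<le> k"
      "x \<in> carrier (integer_mod_group (p ^ k))" "x \<noteq> 0"
      by (auto simp: fund_poset_def)
    obtain u where u: "x = int p ^ multiplicity (int p) x * u" "\<not> int p dvd u"
      using multiplicity_decompose'[of x "int p"] X(4) p(1) by (metis not_prime_unit)
    define r where "r = multiplicity (int p) x"
    have x: "0 < x" "x < int p ^ k"
      using X(3,4) p(2) by (auto simp: carrier_integer_mod_group split: if_splits)
    have "int p ^ r \<le> x" using x(1) by (simp add: r_def zdvd_imp_le multiplicity_dvd)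
    then have "r < k" using x(2) p(2)
      by (metis le_less_trans of_nat_1 of_nat_less_iff power_less_imp_less_exp)
    interpret group_action "AutoGroup (integer_mod_group (p ^ k))"
      "carrier (integer_mod_group (p ^ k))" "\<lambda>f. f"
      by (rule AutoGroup_action) simp
    let ?O = "orbit (AutoGroup (integer_mod_group (p ^ k))) (\<lambda>f. f)"
    have rC: "int p ^ r \<in> carrier (integer_mod_group (p ^ k))"
      using \<open>r < k\<close> p(2) by (simp add: carrier_integer_mod_group)
    have O: "?O y \<subseteq> carrier (integer_mod_group (p ^ k))"
      if "y \<in> carrier (integer_mod_group (p ^ k))" for y
      using that element_image by (auto simp: orbit_def)
    have "x \<in> ?O (int p ^ r)"
      using fund_orbit_prime_power[OF assms \<open>r < k\<close>] u X(3)
      by (auto simp: fund_orbit_def r_def)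
    then have "?O x = ?O (int p ^ r)"
      using O orbit_sym[OF rC X(3)] orbit_trans rC X(3) by (meson subset_antisym subset_iff)
    then show "X \<in> {fund_orbit p k (int p ^ r) | r k. r < k}"
      using X(1) \<open>r < k\<close> by (auto simp: fund_orbit_def)
  next
    fix X assume "X \<in> {fund_orbit p k (int p ^ r) | r k. r < k}"
    then show "X \<in> fund_poset p" using p(2)
      by (force simp: fund_poset_def carrier_integer_mod_group)
  }
qed

end

(* The order on orbits is degeneration of representatives, so I(b) is contained in I(a) iff every
   nonzero coordinate of b is a degeneration of some coordinate of a. Such degenerations assemble
   to a homomorphism into the direct product. Conversely, a homomorphism that maps a to b writes
   each coordinate of b as a sum of images of the coordinates of a. In Z/p^l the elements that do
   not degenerate to a given y = p^s u are multiples of p^(s+1), hence some summand degenerates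
   to y. *)

theory Submission
  imports Defs
begin

section \<open>Degeneration as a preorder, and its descent to orbits\<close>

lemma degeneratesI: "\<phi> \<in> hom A B \<Longrightarrow> \<phi> a = b \<Longrightarrow> degenerates A a B b"
  by (auto simp: degenerates_def)

lemma degenerates_refl: "degenerates A a A a"
  by (rule degeneratesI[of "\<lambda>x. x"]) (auto simp: hom_def)

lemma degenerates_trans [trans]:
  assumes "degenerates A a B b" "degenerates B b C c"
  shows "degenerates A a C c"
proof -
  obtain f g where "f \<in> hom A B" "f a = b" "g \<in> hom B C" "g b = c"
    using assms by (auto simp: degenerates_def)
  then show ?thesis by (intro degeneratesI[of "g \<circ> f"] hom_compose) auto
qed

lemma degenerates_orbit:
  assumes "y \<in> orbit (AutoGroup G) (\<lambda>f. f) x"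
  shows "degenerates G x G y"
  using assms by (auto simp: orbit_def AutoGroup_def auto_def degenerates_def)

text \<open>Any two members of an automorphism orbit degenerate to each other. So a degeneration
  between some representatives can be composed on both sides with automorphisms to give one between
  \<open>x\<close> and \<open>y\<close>.\<close>

lemma fund_ge_iff_degenerates:
  assumes "x \<in> carrier (integer_mod_group (p ^ k))" "y \<in> carrier (integer_mod_group (p ^ l))"
  shows "fund_ge p (fund_orbit p k x) (fund_orbit p l y) \<longleftrightarrow>
    degenerates (integer_mod_group (p ^ k)) x (integer_mod_group (p ^ l)) y"
    (is "?L \<longleftrightarrow> ?R")
proof
  let ?G = "integer_mod_group (p ^ k)" and ?H = "integer_mod_group (p ^ l)"
  interpret G: group_action "AutoGroup ?G" "carrier ?G" "\<lambda>f. f"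
    by (rule AutoGroup_action) simp
  interpret H: group_action "AutoGroup ?H" "carrier ?H" "\<lambda>f. f"
    by (rule AutoGroup_action) simp
  {
    assume ?L
    then obtain x' y' where x': "x' \<in> orbit (AutoGroup ?G) (\<lambda>f. f) x"
      and y': "y' \<in> orbit (AutoGroup ?H) (\<lambda>f. f) y" and d: "degenerates ?G x' ?H y'"
      by (auto simp: fund_ge_def fund_orbit_def)
    have "y' \<in> carrier ?H"
      using y' H.element_image assms(2) by (auto simp: orbit_def)
    then have y: "y \<in> orbit (AutoGroup ?H) (\<lambda>f. f) y'"
      using H.orbit_sym assms(2) y' by blast
    show ?R
      by (rule degenerates_trans[OF degenerates_orbit[OF x']
            degenerates_trans[OF d degenerates_orbit[OF y]]])
  next
    assume ?R
    then show ?L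
      using G.orbit_refl[OF assms(1)] H.orbit_refl[OF assms(2)]
      by (auto simp: fund_ge_def fund_orbit_def)
  }
qed

section \<open>Ideals of the fundamental poset\<close>

lemma fund_ge_refl:
  assumes "X \<in> fund_poset p"
  shows "fund_ge p X X"
  using assms degenerates_refl by (auto simp: fund_poset_def fund_ge_iff_degenerates)

lemma fund_ge_trans:
  assumes "X \<in> fund_poset p" "Y \<in> fund_poset p" "Z \<in> fund_poset p"
    and "fund_ge p X Y" "fund_ge p Y Z"
  shows "fund_ge p X Z"
  using assms degenerates_trans by (fastforce simp: fund_poset_def fund_ge_iff_degenerates)

text \<open>By reflexivity the right-hand side contains \<open>S\<close>, and by transitivity it is
  down-closed. Every ideal containing \<open>S\<close> must contain it.\<close>

lemma fund_ideal_hull: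
  assumes "S \<subseteq> fund_poset p"
  shows "fund_ideal p hull S = {Y \<in> fund_poset p. \<exists>X\<in>S. fund_ge p X Y}" (is "_ = ?J")
proof (rule hull_unique)
  show "S \<subseteq> ?J" using assms fund_ge_refl by blast
  show "fund_ideal p ?J"
    using assms fund_ge_trans unfolding fund_ideal_def by blast
  show "?J \<subseteq> J" if "S \<subseteq> J" "fund_ideal p J" for J
    using that unfolding fund_ideal_def by blast
qed

lemma fund_orbit_coord_in_poset:
  assumes "a \<in> carrier (part_group p lam)" "i < length lam" "a i \<noteq> 0"
  shows "fund_orbit p (lam ! i) (a i) \<in> fund_poset p"
proof -
  have "a i \<in> carrier (integer_mod_group (p ^ (lam ! i)))"
    using assms(1,2) by (auto simp: part_group_def)
  \<comment> \<open>For exponent 0 the group is Z/1, whose only element is 0.\<close>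
  moreover from this have "lam ! i \<noteq> 0"
    using assms(3) by (intro notI) (auto simp: carrier_integer_mod_group)
  ultimately show ?thesis using assms(3) by (fastforce simp: fund_poset_def)
qed

text \<open>This removes ideals from the theorem: an inclusion of generated ideals need only be
  tested on generators, and a generator lies in I(a) iff it lies below a generator of I(a).\<close>

lemma elem_ideal_subset_iff:
  assumes a: "a \<in> carrier (part_group p lam)" and b: "b \<in> carrier (part_group p mu)"
  shows "elem_ideal p mu b \<subseteq> elem_ideal p lam a \<longleftrightarrow>
    (\<forall>j<length mu. b j \<noteq> 0 \<longrightarrow> (\<exists>i<length lam. a i \<noteq> 0 \<and>
      degenerates (integer_mod_group (p ^ (lam ! i))) (a i) (integer_mod_group (p ^ (mu ! j))) (b j)))"
    (is "_ \<longleftrightarrow> ?R")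
proof -
  let ?S = "\<lambda>lam a. {fund_orbit p (lam ! i) (a i) | i. i < length lam \<and> a i \<noteq> 0}"
  have S: "?S lam a \<subseteq> fund_poset p" "?S mu b \<subseteq> fund_poset p"
    using fund_orbit_coord_in_poset[OF a] fund_orbit_coord_in_poset[OF b] by auto
  note hull_a = fund_ideal_hull[OF S(1)]
  \<comment> \<open>\<open>subset_hull\<close> compares a hull only with a set that is itself an
    ideal, so this must be known for I(a).\<close>
  have "fund_ideal p (fund_ideal p hull ?S lam a)"
    unfolding hull_a using S(1) fund_ge_trans unfolding fund_ideal_def by blast
  then have "elem_ideal p mu b \<subseteq> elem_ideal p lam a \<longleftrightarrow>
      ?S mu b \<subseteq> {Y \<in> fund_poset p. \<exists>X\<in>?S lam a. fund_ge p X Y}"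
    unfolding elem_ideal_def by (metis (no_types, lifting) hull_a subset_hull)
  also have "\<dots> \<longleftrightarrow> (\<forall>j<length mu. b j \<noteq> 0 \<longrightarrow> (\<exists>i<length lam. a i \<noteq> 0 \<and>
      fund_ge p (fund_orbit p (lam ! i) (a i)) (fund_orbit p (mu ! j) (b j))))"
    using S(2) by blast
  also have "\<dots> \<longleftrightarrow> ?R"
  proof -
    have "fund_ge p (fund_orbit p (lam ! i) (a i)) (fund_orbit p (mu ! j) (b j)) \<longleftrightarrow>
        degenerates (integer_mod_group (p ^ (lam ! i))) (a i) (integer_mod_group (p ^ (mu ! j))) (b j)"
      if "i < length lam" "j < length mu" for i j
      using a b that by (intro fund_ge_iff_degenerates) (auto simp: part_group_def)
    then show ?thesis by blast
  qed
  finally show ?thesis .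
qed

section \<open>Maps into and out of direct products\<close>

lemma hom_product_group_proj:
  assumes "i \<in> I"
  shows "(\<lambda>x. x i) \<in> hom (product_group I G) (G i)"
  using assms by (auto simp: hom_def)

lemma hom_product_group_inj:
  assumes "\<And>j. j \<in> I \<Longrightarrow> group (G j)" "i \<in> I"
  shows "(\<lambda>x. \<lambda>j\<in>I. if j = i then x else \<one>\<^bsub>G j\<^esub>) \<in> hom (G i) (product_group I G)"
  using assms by (auto simp: hom_def group.is_monoid monoid.one_closed monoid.l_one
      intro!: restrict_ext)

lemma hom_product_group_tuple:
  assumes "\<And>j. j \<in> I \<Longrightarrow> f j \<in> hom A (G j)"
  shows "(\<lambda>x. \<lambda>j\<in>I. f j x) \<in> hom A (product_group I G)"
  using assms by (fastforce simp: hom_def intro!: restrict_ext)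

text \<open>Over a finite index set, \<open>a\<close> is the product of the elements that keep one
  coordinate of \<open>a\<close> and are trivial elsewhere. Hence a property closed under products
  need only be checked on these.\<close>

lemma product_group_coord_induct:
  assumes G: "\<And>i. i \<in> I \<Longrightarrow> group (G i)" and "finite I"
    and a: "a \<in> carrier (product_group I G)"
    and one: "P \<one>\<^bsub>product_group I G\<^esub>"
    and mult: "\<And>x y. \<lbrakk>x \<in> carrier (product_group I G); y \<in> carrier (product_group I G); P x; P y\<rbrakk>
      \<Longrightarrow> P (x \<otimes>\<^bsub>product_group I G\<^esub> y)"
    and coord: "\<And>i. i \<in> I \<Longrightarrow> P (\<lambda>j\<in>I. if j = i then a i else \<one>\<^bsub>G j\<^esub>)"
  shows "P a"
proof -
  \<comment> \<open>\<open>r S\<close> truncates \<open>a\<close> to the coordinates in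
    \<open>S\<close>; the induction enlarges \<open>S\<close> up to \<open>I\<close>.\<close>
  define r where "r S = (\<lambda>j\<in>I. if j \<in> S then a j else \<one>\<^bsub>G j\<^esub>)" for S
  have aC: "a i \<in> carrier (G i)" if "i \<in> I" for i using a that by auto
  have rC: "r S \<in> carrier (product_group I G)" for S
    using aC G by (auto simp: r_def group.is_monoid monoid.one_closed)
  have "P (r S)" if "S \<subseteq> I" for S
    using finite_subset[OF that \<open>finite I\<close>] that
  proof (induction S rule: finite_induct)
    case empty
    show ?case using one by (simp add: r_def restrict_def)
  next
    case (insert i S)
    have "r {i} = (\<lambda>j\<in>I. if j = i then a i else \<one>\<^bsub>G j\<^esub>)"
      by (auto simp: r_def)
    then have "P (r {i})" using coord insert.prems by simp
    \<comment> \<open>Since \<open>i\<close> is not in \<open>S\<close>, at each index at least one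
      of the two factors is trivial.\<close>
    moreover have "r (insert i S) = r S \<otimes>\<^bsub>product_group I G\<^esub> r {i}"
      using aC G insert.hyps(2)
      by (auto simp: r_def group.is_monoid monoid.l_one monoid.r_one monoid.one_closed
          intro!: restrict_ext)
    ultimately show ?case using mult[OF rC rC] insert by (simp only: insert_subset)
  qed
  moreover have "r I = a" using a by (auto simp: r_def PiE_iff extensional_def)
  ultimately show ?thesis by auto
qed

section \<open>Degeneration inside one cyclic group\<close>

lemma degenerates_integer_mod_group_gcd:
  assumes "0 < n" "y \<in> carrier (integer_mod_group n)" "gcd x (int n) dvd y"
  shows "degenerates (integer_mod_group n) x (integer_mod_group n) y"
proof -
  \<comment> \<open>Bezout supplies the endomorphism: if y = gcd(x,n) k, then multiplication by
    \<open>u * k\<close> sends \<open>x\<close> to \<open>y\<close> modulo \<open>n\<close>.\<close>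
  obtain u v where "u * x + v * int n = gcd x (int n)" using bezout_int by blast
  moreover obtain k where "y = gcd x (int n) * k" using assms(3) by (elim dvdE)
  ultimately have "y = (u * x + v * int n) * k" by simp
  then have "y = (u * k) * x + (v * k) * int n" by (simp only: algebra_simps)
  then have "(u * k) * x mod int n = y mod int n" by (metis mod_mult_self1)
  also have "\<dots> = y" using assms(1,2) by (simp add: carrier_integer_mod_group)
  finally show ?thesis
    by (intro degeneratesI[OF hom_integer_mod_groupI]) (use assms(1) in auto)
qed

text \<open>The gcd of \<open>x\<close> and p^l is a power p^t, and t \<le> s because p^(s+1) does
  not divide \<open>x\<close>. So the gcd divides \<open>y\<close>.\<close>

lemma degenerates_prime_power:
  assumes "prime p" "y \<in> carrier (integer_mod_group (p ^ l))"
    and "int p ^ s dvd y" "\<not> int p ^ Suc s dvd x"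
  shows "degenerates (integer_mod_group (p ^ l)) x (integer_mod_group (p ^ l)) y"
proof (rule degenerates_integer_mod_group_gcd)
  have "gcd x (int (p ^ l)) dvd int p ^ l" by simp
  then obtain t where t: "gcd x (int (p ^ l)) = int p ^ t"
    using divides_primepow_weak[of "int p" "gcd x (int (p ^ l))" l] assms(1) by auto
  then have "int p ^ t dvd x" by (metis gcd_dvd1)
  then have "t \<le> s" using assms(4) by (metis dvd_trans le_imp_power_dvd not_less_eq_eq)
  then show "gcd x (int (p ^ l)) dvd y"
    unfolding t using assms(3) by (metis dvd_trans le_imp_power_dvd)
qed (use assms prime_gt_0_nat in auto)

theorem theorem4p1:
  fixes p :: nat and lam mu :: "nat list" and a b :: "nat \<Rightarrow> int"
  assumes "prime p"
    and "is_partition lam" and "is_partition mu"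
    and "a \<in> carrier (part_group p lam)" and "b \<in> carrier (part_group p mu)"
  shows "degenerates (part_group p lam) a (part_group p mu) b \<longleftrightarrow>
    elem_ideal p mu b \<subseteq> elem_ideal p lam a"
proof -
  let ?I = "{..<length lam}" and ?J = "{..<length mu}"
  let ?G = "\<lambda>i. integer_mod_group (p ^ (lam ! i))" and ?H = "\<lambda>j. integer_mod_group (p ^ (mu ! j))"
  have p: "prime (int p)" "0 < p" using assms(1) prime_gt_0_nat by auto
  have bC: "b j \<in> carrier (?H j)" if "j \<in> ?J" for j
    using assms(5) that by (auto simp: part_group_def)
  have "degenerates (part_group p lam) a (part_group p mu) b \<longleftrightarrow>
    (\<forall>j<length mu. b j \<noteq> 0 \<longrightarrow> (\<exists>i<length lam. a i \<noteq> 0 \<and> degenerates (?G i) (a i) (?H j) (b j)))"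
    (is "?L \<longleftrightarrow> ?R")
  proof
    assume ?L
    then obtain \<phi> where \<phi>: "\<phi> \<in> hom (part_group p lam) (part_group p mu)" "\<phi> a = b"
      by (auto simp: degenerates_def)
    show ?R
    proof (intro allI impI)
      fix j assume j: "j < length mu" "b j \<noteq> 0"
      define \<psi> where "\<psi> x = \<phi> x j" for x
      have \<psi>: "\<psi> \<in> hom (product_group ?I ?G) (?H j)"
        using hom_compose[OF \<phi>(1)[unfolded part_group_def] hom_product_group_proj[of j]] j
        by (simp add: \<psi>_def[abs_def] comp_def)
      interpret \<psi>: group_hom "product_group ?I ?G" "?H j" \<psi>
        using \<psi> by (simp add: group_hom_def group_hom_axioms_def)
      have \<psi>a: "\<psi> a = b j" by (simp add: \<psi>_def \<phi>(2))
      define s where "s = multiplicity (int p) (b j)"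
      have s: "int p ^ s dvd b j" "\<not> int p ^ Suc s dvd b j"
        using j(2) prime_gt_1_nat[OF assms(1)] power_dvd_iff_le_multiplicity[of "b j" "int p" "Suc s"]
        by (auto simp: s_def multiplicity_dvd simp del: power_Suc)
      have "0 < b j" "b j < int p ^ (mu ! j)"
        using bC[of j] j p(2) by (auto simp: carrier_integer_mod_group)
      moreover from this have "int p ^ s \<le> b j" using s(1) by (simp add: zdvd_imp_le)
      ultimately have "int p ^ s < int p ^ (mu ! j)" by linarith
      \<comment> \<open>As p^(s+1) divides the modulus, divisibility by p^(s+1) is unaffected by
        reduction to residues, so the multiples of p^(s+1) are closed under the group
        operation.\<close>
      then have "s < mu ! j"
        using p(1) by (metis power_less_imp_less_exp prime_gt_1_int)
      then have d: "int p ^ Suc s dvd int (p ^ (mu ! j))"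
        unfolding of_nat_power by (intro le_imp_power_dvd) simp
      define e where "e i = (\<lambda>x. \<lambda>k\<in>?I. if k = i then x else \<one>\<^bsub>?G k\<^esub>)" for i
      have e: "e i \<in> hom (?G i) (product_group ?I ?G)" if "i \<in> ?I" for i
        unfolding e_def by (rule hom_product_group_inj) (use that in auto)
      \<comment> \<open>Otherwise p^(s+1) would divide the image of every coordinate of
        \<open>a\<close>, hence also their sum \<open>b j\<close>, against the choice of
        \<open>s\<close>.\<close>
      have "\<exists>i\<in>?I. \<not> int p ^ Suc s dvd \<psi> (e i (a i))"
      proof (rule ccontr)
        assume *: "\<not> ?thesis"
        have "int p ^ Suc s dvd \<psi> a"
        proof (rule product_group_coord_induct[of ?I ?G a "\<lambda>x. int p ^ Suc s dvd \<psi> x"])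
          show "int p ^ Suc s dvd \<psi> \<one>\<^bsub>product_group ?I ?G\<^esub>"
            by (simp only: \<psi>.hom_one one_integer_mod_group dvd_0_right)
        next
          fix x y
          assume "x \<in> carrier (product_group ?I ?G)" "y \<in> carrier (product_group ?I ?G)"
            "int p ^ Suc s dvd \<psi> x" "int p ^ Suc s dvd \<psi> y"
          then show "int p ^ Suc s dvd \<psi> (x \<otimes>\<^bsub>product_group ?I ?G\<^esub> y)"
            by (simp only: \<psi>.hom_mult mult_integer_mod_group dvd_mod_iff[OF d] dvd_add)
        next
          fix i assume "i \<in> ?I"
          then have "int p ^ Suc s dvd \<psi> (e i (a i))" using * by blast
          then show "int p ^ Suc s dvd \<psi> (\<lambda>k\<in>?I. if k = i then a i else \<one>\<^bsub>?G k\<^esub>)"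
            by (simp only: e_def)
        next
          show "a \<in> carrier (product_group ?I ?G)"
            using assms(4) by (simp only: part_group_def)
        qed (rule group_integer_mod_group finite_lessThan)+
        then show False using s(2) \<psi>a by simp
      qed
      then obtain i where i: "i \<in> ?I" "\<not> int p ^ Suc s dvd \<psi> (e i (a i))" by blast
      have "degenerates (?G i) (a i) (?H j) (\<psi> (e i (a i)))"
        by (rule degeneratesI[OF hom_compose[OF e[OF i(1)] \<psi>]]) simp
      \<comment> \<open>The image of the chosen coordinate need not equal \<open>b j\<close>, but
        its p-adic order is at most that of \<open>b j\<close>, so an endomorphism of the target
        corrects it.\<close>
      also have "degenerates (?H j) (\<psi> (e i (a i))) (?H j) (b j)"
        by (rule degenerates_prime_power[OF assms(1) _ s(1) i(2)]) (use bC j in auto)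
      finally have "degenerates (?G i) (a i) (?H j) (b j)" .
      \<comment> \<open>A zero coordinate would have image 0, which p^(s+1) divides.\<close>
      moreover have "a i \<noteq> 0"
      proof
        assume "a i = 0"
        then have "e i (a i) = \<one>\<^bsub>product_group ?I ?G\<^esub>" by (auto simp: e_def)
        then have "\<psi> (e i (a i)) = 0" by (simp only: \<psi>.hom_one one_integer_mod_group)
        then show False using i(2) by simp
      qed
      ultimately show "\<exists>i<length lam. a i \<noteq> 0 \<and> degenerates (?G i) (a i) (?H j) (b j)"
        using i(1) by blast
    qed
  next
    assume R: ?R
    \<comment> \<open>Each coordinate of \<open>b\<close> is reached separately: by the zero map if
      it vanishes, otherwise by projecting to a suitable factor and applying the degeneration given
      there.\<close>
    have "\<exists>f. f \<in> hom (part_group p lam) (?H j) \<and> f a = b j" if j: "j \<in> ?J" for j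
    proof (cases "b j = 0")
      case True
      have "(\<lambda>_. 0) \<in> hom (part_group p lam) (?H j)" by (auto simp: hom_def)
      then show ?thesis using True by (intro exI[of _ "\<lambda>_. 0"]) simp
    next
      case False
      then obtain i f where "i \<in> ?I" "f \<in> hom (?G i) (?H j)" "f (a i) = b j"
        using R j by (auto simp: degenerates_def)
      then show ?thesis
        unfolding part_group_def
        by (intro exI[of _ "f \<circ> (\<lambda>x. x i)"] conjI hom_compose[OF hom_product_group_proj]) auto
    qed
    then obtain f where f: "\<And>j. j \<in> ?J \<Longrightarrow> f j \<in> hom (part_group p lam) (?H j) \<and> f j a = b j"
      by metis
    have "(\<lambda>x. \<lambda>j\<in>?J. f j x) \<in> hom (part_group p lam) (part_group p mu)"
      using f unfolding part_group_def[of p mu] by (intro hom_product_group_tuple) blast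
    \<comment> \<open>Outside \<open>?J\<close> both sides are \<open>undefined\<close>, since
      members of the product carrier are extensional.\<close>
    moreover have "(\<lambda>j\<in>?J. f j a) = b"
      using f assms(5) by (auto simp: part_group_def PiE_iff extensional_def)
    ultimately show ?L by (rule degeneratesI[of "\<lambda>x. \<lambda>j\<in>?J. f j x"])
  qed
  then show ?thesis using elem_ideal_subset_iff[OF assms(4,5)] by blast
qed

end
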